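(* Let $\rho>0$, $J=[0,\rho]$, $f:J\times\mathbb R\to\mathbb R\setminus\{0\}$, $g:J\times\mathbb R\to\mathbb R$ and $\Gamma:C(J)\to\mathbb R$. Assume: (i) for each $x\in\mathbb R$ the maps $t\mapsto f(t,x)$ and $t\mapsto g(t,x)$ are continuous on $J$, and $\Gamma$ is Lipschitz with constant $L_\Gamma\geq 0$; (ii) there exist $r>0$, nondecreasing continuous functions $\varphi,\psi:\mathbb R_+\to\mathbb R_+$, and functions $\alpha,\gamma:J\to\mathbb R_+$, bounded, with $\gamma$ Lebesgue measurable, such that for all $t\in J$ and all $x,y\in\mathbb R$ with $|x|,|y|\le r$, $$|f(t,x)-f(t,y)|\le\alpha(t)\,\varphi(|x-y|),\qquad |g(t,x)-g(t,y)|\le\gamma(t)\,\psi(|x-y|);$$ (iii) there is a constant $\delta>0$ such that $\sup_{x\in\mathbb R,\,|x|\le r}|f(0,x)|^{-1}\le\delta$. Put $$M_F=\|\alpha\|_\infty\varphi(r)+\|f(\cdot,0)\|_\infty,\qquad M_G=\delta\,(L_\Gamma r+|\Gamma(0)|)+\rho\|\gamma\|_\infty\psi(r)+\rho\|g(\cdot,0)\|_\infty.$$ If $$M_F\delta L_\Gamma t+\Big(M_F\delta^2\alpha(0)\big(L_\Gamma r+|\Gamma(0)|\big)+M_G\|\alpha\|_\infty\Big)\varphi(t)+M_F\|\gamma\|_{L^1}\psi(t)<t\quad\text{for all } t>0$$ and $M_FM_G\le r$, then the nonlinear differential problem $$\frac{d}{dt}\left(\frac{x(t)}{f(t,x(t))}\right)=g(t,x(t)),\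 t\in J,\qquad x(0)=\Gamma(x),$$ has a unique solution in $B_r$.
   Context: $C(J)$ is the space of continuous functions $J\to\mathbb R$ with norm $\|x\|_\infty=\sup_{t\in J}|x(t)|$, and $B_r=\{x\in C(J):\|x\|_\infty\le r\}$. $\|\alpha\|_\infty$, $\|\gamma\|_\infty$ denote suprema over $J$, and $\|\gamma\|_{L^1}=\int_0^\rho|\gamma(s)|\,ds$. $\Gamma(0)$ is the value of $\Gamma$ at the zero function. A solution is understood as a function $x\in C(J)$; the problem is equivalent to the fixed point equation $x(t)=f(t,x(t))\left[\frac{\Gamma(x)}{f(0,x(0))}+\int_0^t g(s,x(s))\,ds\right]$, $t\in J$. *)

theory Defs
  imports "HOL-Analysis.Analysis"
begin

text \<open>
  Throughout, \<open>J = {0..\<rho>}\<close>. Functions on \<open>J\<close> are HOL functions on \<open>real\<close>. Elements of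
  \<open>C(J)\<close> take the value \<open>undefined\<close> off \<open>J\<close> (\<^const>\<open>extensional\<close>), so that HOL equality
  of two elements is equality on \<open>J\<close>, and \<open>\<exists>!\<close> is uniqueness in \<open>C(J)\<close>.
\<close>

definition CJ :: "real \<Rightarrow> (real \<Rightarrow> real) set" where
  "CJ \<rho> = {x \<in> extensional {0..\<rho>}. continuous_on {0..\<rho>} x}"

definition zeroJ :: "real \<Rightarrow> real \<Rightarrow> real" where
  "zeroJ \<rho> = restrict (\<lambda>_. 0) {0..\<rho>}"

text \<open>
  As a supremum in \<open>real\<close>, this is meaningful only for \<open>h\<close> bounded on \<open>J\<close> and \<open>\<rho> \<ge> 0\<close>.
\<close>

definition supnorm :: "real \<Rightarrow> (real \<Rightarrow> real) \<Rightarrow> real" where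
  "supnorm \<rho> h = (SUP t\<in>{0..\<rho>}. \<bar>h t\<bar>)"

definition L1norm :: "real \<Rightarrow> (real \<Rightarrow> real) \<Rightarrow> real" where
  "L1norm \<rho> h = (LINT s|lebesgue_on {0..\<rho>}. \<bar>h s\<bar>)"

definition Bball :: "real \<Rightarrow> real \<Rightarrow> (real \<Rightarrow> real) set" where
  "Bball \<rho> r = {x \<in> CJ \<rho>. supnorm \<rho> x \<le> r}"

definition lipschitz_CJ :: "real \<Rightarrow> real \<Rightarrow> ((real \<Rightarrow> real) \<Rightarrow> real) \<Rightarrow> bool" where
  "lipschitz_CJ \<rho> L \<Gamma> \<longleftrightarrow>
     0 \<le> L \<and> (\<forall>x\<in>CJ \<rho>. \<forall>y\<in>CJ \<rho>. \<bar>\<Gamma> x - \<Gamma> y\<bar> \<le> L * supnorm \<rho> (\<lambda>t. x t - y t))"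

text \<open>
  The differential equation is understood classically: it holds at every point of \<open>J\<close>, with
  one-sided derivatives at the end points. Only the quotient, not \<open>x\<close> itself, need be
  differentiable.
\<close>

definition is_solution ::
  "real \<Rightarrow> (real \<Rightarrow> real \<Rightarrow> real) \<Rightarrow> (real \<Rightarrow> real \<Rightarrow> real) \<Rightarrow> ((real \<Rightarrow> real) \<Rightarrow> real) \<Rightarrow> (real \<Rightarrow> real) \<Rightarrow> bool" where
  "is_solution \<rho> f g \<Gamma> x \<longleftrightarrow>
     x \<in> CJ \<rho> \<and>
     (\<forall>t\<in>{0..\<rho>}. ((\<lambda>s. x s / f s (x s)) has_real_derivative g t (x t)) (at t within {0..\<rho>})) \<and>
     x 0 = \<Gamma> x"

end

theory Submission
  imports Defs
begin

text \<open>
  Integrating the equation turns the problem on the ball \<open>B\<^sub>r\<close> into the fixed point equation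
  \<open>x = T x\<close> with \<open>T x = F x * G x\<close>, where \<open>F x t = f t (x t)\<close> and
  \<open>G x t = \<Gamma> x / f 0 (x 0) + (integral of g s (x s) over {0..t})\<close>
  (\<open>is_solution_iff_fixed_point\<close>). On \<open>B\<^sub>r\<close> one has \<open>\<bar>F x\<bar> \<le> MF\<close> and \<open>\<bar>G x\<bar> \<le> MG\<close>, so
  \<open>MF * MG \<le> r\<close> makes \<open>T\<close> map the ball into itself. The product rule
  \<open>F x * G x - F y * G y = F x * (G x - G y) + G y * (F x - F y)\<close> together with the moduli of
  \<open>f\<close>, \<open>g\<close> and \<open>\<Gamma>\<close> gives \<open>\<parallel>T x - T y\<parallel> \<le> \<Phi> \<parallel>x - y\<parallel>\<close>, where \<open>\<Phi> t\<close> is precisely the left-hand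
  side of the smallness condition. As \<open>\<Phi>\<close> is nondecreasing and continuous with \<open>\<Phi> t < t\<close>, Browder's
  fixed point theorem for nonlinear contractions (\<open>Browder_fixed_point\<close>) applies on the complete
  metric space \<open>B\<^sub>r\<close> (\<open>mcomplete_Bball\<close>).

  The delicate point is that \<open>\<phi> 0 = 0\<close> and \<open>\<psi> 0 = 0\<close> are not assumed, so that neither
  \<open>f t (x t)\<close> nor \<open>g t (x t)\<close> is obviously continuous in \<open>t\<close>. But \<open>\<Phi> 0 \<le> 0\<close> by continuity, and since
  all terms of \<open>\<Phi> 0\<close> are nonnegative, each of them vanishes. Hence \<open>\<psi> 0 = 0\<close> or \<open>\<parallel>\<gamma>\<parallel> = 0\<close> in
  \<open>L\<^sup>1\<close>; in the second case \<open>g t\<close> is constant on \<open>{-r..r}\<close> for every \<open>t\<close>. Likewise \<open>f\<close> has a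
  modulus vanishing at \<open>0\<close>, or \<open>MG = 0\<close>; in the second case \<open>G x = 0\<close>, and \<open>T x = 0\<close> is continuous
  although \<open>F x\<close> may fail to be.
\<close>

section \<open>Browder's fixed point theorem\<close>

text \<open>
  The distances between consecutive iterates decrease to a limit \<open>L\<close> with \<open>L \<le> \<Phi> L\<close>, so to \<open>0\<close>.
  They need not be summable; instead, once a single step from \<open>\<sigma> N\<close> is shorter than \<open>\<eta> - \<Phi> \<eta>\<close>,
  the ball of radius \<open>\<eta>\<close> around \<open>\<sigma> N\<close> is invariant under \<open>T\<close> and traps all later iterates.
\<close>

theorem (in Metric_space) Browder_fixed_point:
  assumes complete: mcomplete and nonempty: "M \<noteq> {}" and self_map: "T \<in> M \<rightarrow> M"
    and mono: "mono_on {0..} \<Phi>" and cont: "continuous_on {0..} \<Phi>"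
    and less: "\<And>t. t > 0 \<Longrightarrow> \<Phi> t < t"
    and contr: "\<And>x y. x \<in> M \<Longrightarrow> y \<in> M \<Longrightarrow> d (T x) (T y) \<le> \<Phi> (d x y)"
  shows "\<exists>!x. x \<in> M \<and> T x = x"
proof -
  have T: "T x \<in> M" if "x \<in> M" for x
    using self_map that by blast
  have nonexp: "d (T x) (T y) \<le> d x y" if "x \<in> M" "y \<in> M" for x y
  proof (cases "x = y")
    case False
    then have "d x y > 0"
      using that by (meson mdist_pos_eq)
    then show ?thesis
      using contr[OF that] less by fastforce
  qed (use that T in simp)
  obtain a where a: "a \<in> M"
    using nonempty by blast
  define \<sigma> where "\<sigma> n = (T ^^ n) a" for n
  have \<sigma>_Suc: "\<sigma> (Suc n) = T (\<sigma> n)" for n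
    by (simp add: \<sigma>_def)
  have \<sigma>: "\<sigma> n \<in> M" for n
    by (induction n) (use a T \<sigma>_Suc in \<open>auto simp: \<sigma>_def\<close>)

  define e where "e n = d (\<sigma> n) (\<sigma> (Suc n))" for n
  have e_le: "e (Suc n) \<le> \<Phi> (e n)" for n
    using contr[OF \<sigma>[of n] \<sigma>[of "Suc n"]] by (simp add: e_def \<sigma>_Suc)
  have "decseq e"
    using nonexp[OF \<sigma> \<sigma>] by (intro decseq_SucI) (metis e_def \<sigma>_Suc)
  moreover have "0 \<le> e n" for n
    by (simp add: e_def)
  ultimately obtain L where L: "e \<longlonglongrightarrow> L" and "0 \<le> L"
    using decseq_convergent[of e 0] by (metis LIMSEQ_le_const)
  have "(\<lambda>n. \<Phi> (e n)) \<longlonglongrightarrow> \<Phi> L"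
    by (rule continuous_on_tendsto_compose[OF cont L]) (use \<open>0 \<le> L\<close> e_def in auto)
  then have "L \<le> \<Phi> L"
    using LIMSEQ_le[OF LIMSEQ_Suc[OF L]] e_le by blast
  then have "L = 0"
    using less[of L] \<open>0 \<le> L\<close> by fastforce
  with L have e_0: "e \<longlonglongrightarrow> 0"
    by simp

  have "MCauchy \<sigma>"
    unfolding MCauchy_def
  proof (intro conjI allI impI)
    fix \<epsilon> :: real
    assume "\<epsilon> > 0"
    \<comment> \<open>A third, since the strict bound \<open>\<epsilon>\<close> must exceed the sum of two distances up to \<open>\<eta>\<close>.\<close>
    define \<eta> where "\<eta> = \<epsilon> / 3"
    have "\<eta> > 0"
      using \<open>\<epsilon> > 0\<close> by (simp add: \<eta>_def)
    then have "\<eta> - \<Phi> \<eta> > 0"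
      using less by simp
    then obtain N where N: "e N < \<eta> - \<Phi> \<eta>"
      using order_tendstoD(2)[OF e_0] by (metis eventually_sequentially order_refl)
    have near: "d (\<sigma> N) (\<sigma> (N + k)) \<le> \<eta>" for k
    proof (induction k)
      case 0
      then show ?case
        using \<sigma> \<open>\<eta> > 0\<close> by simp
    next
      case (Suc k)
      have "d (\<sigma> N) (\<sigma> (N + Suc k)) \<le> e N + d (T (\<sigma> N)) (T (\<sigma> (N + k)))"
        using triangle[OF \<sigma> \<sigma> \<sigma>, of N "N + Suc k" "Suc N"] by (simp add: e_def \<sigma>_Suc)
      also have "\<dots> \<le> e N + \<Phi> (d (\<sigma> N) (\<sigma> (N + k)))"
        using contr[OF \<sigma> \<sigma>] by simp
      also have "\<dots> \<le> e N + \<Phi> \<eta>"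
        using mono_onD[OF mono _ _ Suc.IH] \<open>\<eta> > 0\<close> by simp
      finally show ?case
        using N by simp
    qed
    have "d (\<sigma> m) (\<sigma> n) < \<epsilon>" if "N \<le> m" "N \<le> n" for m n
    proof -
      have "d (\<sigma> m) (\<sigma> n) \<le> d (\<sigma> N) (\<sigma> m) + d (\<sigma> N) (\<sigma> n)"
        using triangle[OF \<sigma> \<sigma> \<sigma>, of m n N] by (simp add: commute)
      also have "\<dots> \<le> \<eta> + \<eta>"
        using near[of "m - N"] near[of "n - N"] that by simp
      finally show ?thesis
        using \<open>\<eta> > 0\<close> by (simp add: \<eta>_def)
    qed
    then show "\<exists>N. \<forall>n n'. N \<le> n \<longrightarrow> N \<le> n' \<longrightarrow> d (\<sigma> n) (\<sigma> n') < \<epsilon>"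
      by blast
  qed (use \<sigma> in auto)
  then obtain x where lim: "limitin mtopology \<sigma> x sequentially"
    using complete unfolding mcomplete_def by blast
  then have x: "x \<in> M" and to_0: "(\<lambda>n. d (\<sigma> n) x) \<longlonglongrightarrow> 0"
    by (auto simp: limitin_metric_dist_null)
  have "T x = x"
  proof -
    have "d (T x) x \<le> d (\<sigma> n) x + d (\<sigma> (Suc n)) x" for n
      using triangle[OF T[OF x] \<sigma> x, of "Suc n"] nonexp[OF x \<sigma>, of n] by (simp add: \<sigma>_Suc commute)
    then have "d (T x) x \<le> 0 + 0"
      by (intro LIMSEQ_le_const[OF tendsto_add[OF to_0 LIMSEQ_Suc[OF to_0]]]) auto
    then show ?thesis
      using x T zero nonneg by (metis add.right_neutral order_antisym)
  qed
  moreover have "y = x" if "y \<in> M" "T y = y" for y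
  proof (rule ccontr)
    assume "y \<noteq> x"
    then have "d y x > 0"
      using that x by (meson mdist_pos_eq)
    then show False
      using contr[of y x] less[of "d y x"] that x \<open>T x = x\<close> by simp
  qed
  ultimately show ?thesis
    using x by blast
qed

section \<open>The ball of C(J) as a complete metric space\<close>

lemma abs_le_supnorm:
  assumes "bounded (h ` {0..\<rho>})" "t \<in> {0..\<rho>}"
  shows "\<bar>h t\<bar> \<le> supnorm \<rho> h"
proof -
  obtain B where "\<And>s. s \<in> {0..\<rho>} \<Longrightarrow> \<bar>h s\<bar> \<le> B"
    using assms(1) unfolding bounded_real by blast
  then show ?thesis
    unfolding supnorm_def using assms(2) by (intro cSUP_upper bdd_aboveI2[of _ _ B]) auto
qed

lemma supnorm_le:
  assumes "0 \<le> \<rho>" "\<And>t. t \<in> {0..\<rho>} \<Longrightarrow> \<bar>h t\<bar> \<le> c"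
  shows "supnorm \<rho> h \<le> c"
  unfolding supnorm_def using assms by (intro cSUP_least) auto

lemma bounded_continuous_image:
  fixes h :: "real \<Rightarrow> real"
  assumes "continuous_on {a..b} h"
  shows "bounded (h ` {a..b})"
  by (simp add: assms compact_continuous_image compact_imp_bounded)

lemma Bball_iff:
  assumes "0 \<le> \<rho>"
  shows "x \<in> Bball \<rho> r \<longleftrightarrow> x \<in> CJ \<rho> \<and> (\<forall>t\<in>{0..\<rho>}. \<bar>x t\<bar> \<le> r)"
proof -
  have "bounded (x ` {0..\<rho>})" if "x \<in> CJ \<rho>"
    using that by (simp add: CJ_def bounded_continuous_image)
  then show ?thesis
    using supnorm_le[OF assms] abs_le_supnorm[of x \<rho>] unfolding Bball_def by fastforce
qed

text \<open>
  The library's space of bounded continuous maps already consists of extensional functions, so its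
  carrier is exactly \<open>CJ \<rho>\<close>, and completeness can be taken from there. A direct definition of the
  distance by \<^const>\<open>supnorm\<close> would be unspecified, possibly negative, off \<open>CJ \<rho>\<close>.
\<close>

definition CJ_metric :: "real \<Rightarrow> (real \<Rightarrow> real) metric" where
  "CJ_metric \<rho> = cfunspace (top_of_set {0..\<rho>}) euclidean_metric"

lemma mspace_CJ_metric [simp]: "mspace (CJ_metric \<rho>) = CJ \<rho>"
proof -
  have "compactin (top_of_set {0..\<rho>}) {0..\<rho>}"
    by (metis compactin_subtopology compactin_euclidean_iff compact_Icc order_refl)
  then show ?thesis
    using compactin_mspace_cfunspace[of "top_of_set {0..\<rho>}" euclidean_metric]
    by (auto simp: CJ_metric_def CJ_def)
qed

lemma mdist_CJ_metric:
  assumes "0 \<le> \<rho>" "x \<in> CJ \<rho>" "y \<in> CJ \<rho>"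
  shows "mdist (CJ_metric \<rho>) x y = supnorm \<rho> (\<lambda>t. x t - y t)"
proof (rule antisym)
  have xy: "x \<in> mspace (CJ_metric \<rho>)" "y \<in> mspace (CJ_metric \<rho>)"
    using assms by simp_all
  have J: "topspace (top_of_set {0..\<rho>}) \<noteq> {}"
    using \<open>0 \<le> \<rho>\<close> by simp
  note le_iff = cfunspace_mdist_le[OF xy[unfolded CJ_metric_def] J, folded CJ_metric_def]
  have "bounded ((\<lambda>t. x t - y t) ` {0..\<rho>})"
    using assms by (intro bounded_continuous_image continuous_intros) (auto simp: CJ_def)
  then show "mdist (CJ_metric \<rho>) x y \<le> supnorm \<rho> (\<lambda>t. x t - y t)"
    using abs_le_supnorm by (fastforce simp: le_iff dist_real_def)
  show "supnorm \<rho> (\<lambda>t. x t - y t) \<le> mdist (CJ_metric \<rho>) x y"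
    using le_iff[of "mdist (CJ_metric \<rho>) x y"] \<open>0 \<le> \<rho>\<close>
    by (intro supnorm_le) (auto simp: dist_real_def)
qed

lemma zeroJ_in_CJ [simp]: "zeroJ \<rho> \<in> CJ \<rho>"
proof -
  have "continuous_on {0..\<rho>} (zeroJ \<rho>)"
    by (rule continuous_on_eq[of _ "\<lambda>_. 0"]) (auto simp: zeroJ_def)
  then show ?thesis
    by (simp add: CJ_def zeroJ_def)
qed

lemma zeroJ_in_Bball:
  assumes "0 \<le> \<rho>" "0 \<le> r"
  shows "zeroJ \<rho> \<in> Bball \<rho> r"
  using assms by (simp add: Bball_iff) (simp add: zeroJ_def)

lemma supnorm_minus_zeroJ: "supnorm \<rho> (\<lambda>t. x t - zeroJ \<rho> t) = supnorm \<rho> x"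
  by (simp add: supnorm_def zeroJ_def)

text \<open>\<open>B\<^sub>r\<close> is the closed ball around the zero function in a complete space.\<close>

lemma
  assumes "0 \<le> \<rho>" "0 \<le> r"
  shows Metric_space_Bball: "Metric_space (Bball \<rho> r) (mdist (CJ_metric \<rho>))"
    and mcomplete_Bball: "Metric_space.mcomplete (Bball \<rho> r) (mdist (CJ_metric \<rho>))"
proof -
  interpret C: Metric_space "CJ \<rho>" "mdist (CJ_metric \<rho>)"
    using Metric_space_mspace_mdist[of "CJ_metric \<rho>"] by simp
  interpret S: Submetric "CJ \<rho>" "mdist (CJ_metric \<rho>)" "Bball \<rho> r"
    by unfold_locales (auto simp: Bball_def)
  show "Metric_space (Bball \<rho> r) (mdist (CJ_metric \<rho>))"
    by unfold_locales
  have "Bball \<rho> r = C.mcball (zeroJ \<rho>) r"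
    using assms
    by (auto simp: Bball_def C.commute[of "zeroJ \<rho>"] mdist_CJ_metric supnorm_minus_zeroJ)
  then have "closedin C.mtopology (Bball \<rho> r)"
    by simp
  moreover have "mcomplete_of (CJ_metric \<rho>)"
    unfolding CJ_metric_def euclidean_metric_def
    by (rule Met_TC.mcomplete_cfunspace[unfolded Met_TC.Self_def]) (simp add: mcomplete_iff_complete complete_UNIV)
  then have "C.mcomplete"
    by (simp add: mcomplete_of_def)
  ultimately show "S.sub.mcomplete"
    by (rule S.closedin_mcomplete_imp_mcomplete)
qed

section \<open>The equivalent integral equation\<close>

text \<open>
  The modulus \<open>\<omega>\<close> is uniform in \<open>t\<close>, so \<open>h s (x s)\<close> is close to \<open>h s (x t)\<close> for \<open>s\<close> near \<open>t\<close>,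
  and only the continuity of \<open>h\<close> in its first argument remains to be used.
\<close>

lemma continuous_on_superposition:
  fixes h :: "real \<Rightarrow> real \<Rightarrow> real"
  assumes h: "\<And>y. continuous_on S (\<lambda>t. h t y)"
    and modulus: "\<And>t y z. t \<in> S \<Longrightarrow> \<bar>y\<bar> \<le> r \<Longrightarrow> \<bar>z\<bar> \<le> r \<Longrightarrow> \<bar>h t y - h t z\<bar> \<le> \<omega> \<bar>y - z\<bar>"
    and \<omega>: "continuous_on {0..} \<omega>" "\<omega> 0 = 0"
    and x: "continuous_on S x" "\<And>t. t \<in> S \<Longrightarrow> \<bar>x t\<bar> \<le> r"
  shows "continuous_on S (\<lambda>t. h t (x t))"
  unfolding continuous_on_def
proof
  fix t
  assume t: "t \<in> S"
  have "((\<lambda>s. \<bar>x s - x t\<bar>) \<longlongrightarrow> \<bar>x t - x t\<bar>) (at t within S)"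
    using x(1) t by (intro tendsto_intros) (auto simp: continuous_on_def)
  then have "((\<lambda>s. \<omega> \<bar>x s - x t\<bar>) \<longlongrightarrow> \<omega> 0) (at t within S)"
    by (intro continuous_on_tendsto_compose[OF \<omega>(1)]) auto
  then have "((\<lambda>s. \<omega> \<bar>x s - x t\<bar>) \<longlongrightarrow> 0) (at t within S)"
    using \<omega>(2) by simp
  then have "((\<lambda>s. h s (x s) - h s (x t)) \<longlongrightarrow> 0) (at t within S)"
  proof (rule Lim_null_comparison[rotated])
    show "\<forall>\<^sub>F s in at t within S. norm (h s (x s) - h s (x t)) \<le> \<omega> \<bar>x s - x t\<bar>"
      using modulus x(2) t by (auto simp: eventually_at_filter)
  qed
  moreover have "((\<lambda>s. h s (x t)) \<longlongrightarrow> h t (x t)) (at t within S)"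
    using h t by (auto simp: continuous_on_def)
  ultimately show "((\<lambda>s. h s (x s)) \<longlongrightarrow> h t (x t)) (at t within S)"
    using tendsto_add by fastforce
qed

text \<open>
  Both directions are the fundamental theorem of calculus for \<open>x t / f t (x t)\<close>. At \<open>t = 0\<close> the fixed
  point equation reduces to the nonlocal condition \<open>x 0 = \<Gamma> x\<close>.
\<close>

lemma is_solution_iff_fixed_point:
  assumes "0 \<le> \<rho>" and f_nz: "\<And>t y. t \<in> {0..\<rho>} \<Longrightarrow> f t y \<noteq> 0"
    and x: "x \<in> CJ \<rho>" and g: "continuous_on {0..\<rho>} (\<lambda>t. g t (x t))"
  shows "is_solution \<rho> f g \<Gamma> x \<longleftrightarrow>
    (\<forall>t\<in>{0..\<rho>}. x t = f t (x t) * (\<Gamma> x / f 0 (x 0) + integral {0..t} (\<lambda>s. g s (x s))))"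
    (is "_ \<longleftrightarrow> ?fixed")
proof
  assume sol: "is_solution \<rho> f g \<Gamma> x"
  show ?fixed
  proof
    fix t
    assume t: "t \<in> {0..\<rho>}"
    have "((\<lambda>s. g s (x s)) has_integral x t / f t (x t) - x 0 / f 0 (x 0)) {0..t}"
    proof (rule fundamental_theorem_of_calculus)
      fix s
      assume "s \<in> {0..t}"
      then have "((\<lambda>s. x s / f s (x s)) has_real_derivative g s (x s)) (at s within {0..\<rho>})"
        using sol t by (simp add: is_solution_def)
      then have "((\<lambda>s. x s / f s (x s)) has_real_derivative g s (x s)) (at s within {0..t})"
        by (rule has_field_derivative_subset) (use t in auto)
      then show "((\<lambda>s. x s / f s (x s)) has_vector_derivative g s (x s)) (at s within {0..t})"
        by (simp add: has_real_derivative_iff_has_vector_derivative)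
    qed (use t in simp)
    then show "x t = f t (x t) * (\<Gamma> x / f 0 (x 0) + integral {0..t} (\<lambda>s. g s (x s)))"
      using sol f_nz[OF t] by (simp add: is_solution_def integral_unique)
  qed
next
  assume fixed: ?fixed
  have "((\<lambda>s. x s / f s (x s)) has_real_derivative g t (x t)) (at t within {0..\<rho>})"
    if t: "t \<in> {0..\<rho>}" for t
  proof (rule has_field_derivative_transform_within[where d = 1])
    show "((\<lambda>t. \<Gamma> x / f 0 (x 0) + integral {0..t} (\<lambda>s. g s (x s)))
        has_real_derivative g t (x t)) (at t within {0..\<rho>})"
      using DERIV_add[OF DERIV_const integral_has_real_derivative[OF g t]] by simp
    show "\<Gamma> x / f 0 (x 0) + integral {0..s} (\<lambda>s. g s (x s)) = x s / f s (x s)"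
      if "s \<in> {0..\<rho>}" for s
      using bspec[OF fixed that] f_nz[OF that] by (metis nonzero_mult_div_cancel_left)
  qed (use t in auto)
  moreover have "x 0 = \<Gamma> x"
    using bspec[OF fixed, of 0] f_nz[of 0] \<open>0 \<le> \<rho>\<close> by simp
  ultimately show "is_solution \<rho> f g \<Gamma> x"
    using x by (simp add: is_solution_def)
qed

section \<open>Estimates for the contraction\<close>

text \<open>
  The absolute value stands inside the integral so that the bound serves twice: it controls the
  difference of two integrals, and for \<open>\<parallel>\<gamma>\<parallel> = 0\<close> in \<open>L\<^sup>1\<close> it forces the two integrands to agree.
\<close>

lemma integral_abs_diff_le_L1norm:
  fixes u v :: "real \<Rightarrow> real"
  assumes \<gamma>: "\<gamma> \<in> borel_measurable (lebesgue_on {0..\<rho>})" "bounded (\<gamma> ` {0..\<rho>})"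
    and uv: "continuous_on {0..\<rho>} u" "continuous_on {0..\<rho>} v"
    and le: "\<And>s. s \<in> {0..\<rho>} \<Longrightarrow> \<bar>u s - v s\<bar> \<le> \<bar>\<gamma> s\<bar> * c"
    and "0 \<le> c" and t: "t \<in> {0..\<rho>}"
  shows "integral {0..t} (\<lambda>s. \<bar>u s - v s\<bar>) \<le> L1norm \<rho> \<gamma> * c"
proof -
  have "finite_measure (lebesgue_on {0..\<rho>})"
    by (rule finite_measure_lebesgue_on) simp
  moreover obtain B where "\<And>s. s \<in> {0..\<rho>} \<Longrightarrow> \<bar>\<gamma> s\<bar> \<le> B"
    using \<gamma>(2) unfolding bounded_real by blast
  ultimately have "integrable (lebesgue_on {0..\<rho>}) \<gamma>"
    using \<gamma>(1) by (intro finite_measure.integrable_const_bound[of _ _ B]) auto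
  then have int: "((\<lambda>s. \<bar>\<gamma> s\<bar>) has_integral L1norm \<rho> \<gamma>) {0..\<rho>}"
    unfolding L1norm_def by (intro has_integral_integral_lebesgue_on) auto
  have cont: "continuous_on {0..\<rho>} (\<lambda>s. \<bar>u s - v s\<bar>)"
    by (intro continuous_intros uv)
  have "integral {0..t} (\<lambda>s. \<bar>u s - v s\<bar>) \<le> integral {0..\<rho>} (\<lambda>s. \<bar>u s - v s\<bar>)"
    using t by (intro integral_subset_le integrable_continuous_real continuous_on_subset[OF cont]) auto
  also have "\<dots> \<le> L1norm \<rho> \<gamma> * c"
    by (rule has_integral_le[OF integrable_integral has_integral_mult_left[OF int]])
      (use le in \<open>auto intro: integrable_continuous_real cont\<close>)
  finally show ?thesis .
qed

lemma abs_inverse_diff_le: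
  fixes a b :: real
  assumes "a \<noteq> 0" "b \<noteq> 0" "inverse \<bar>a\<bar> \<le> \<delta>" "inverse \<bar>b\<bar> \<le> \<delta>"
  shows "\<bar>inverse a - inverse b\<bar> \<le> \<delta>\<^sup>2 * \<bar>a - b\<bar>"
proof -
  have "\<bar>inverse a - inverse b\<bar> = inverse \<bar>a\<bar> * \<bar>a - b\<bar> * inverse \<bar>b\<bar>"
    using assms(1,2) by (simp add: inverse_diff_inverse abs_mult)
  also have "\<dots> = (inverse \<bar>a\<bar> * inverse \<bar>b\<bar>) * \<bar>a - b\<bar>"
    by simp
  also have "\<dots> \<le> (\<delta> * \<delta>) * \<bar>a - b\<bar>"
    using assms(3,4) order_trans[OF _ assms(3), of 0] by (intro mult_right_mono mult_mono) auto
  finally show ?thesis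
    by (simp add: power2_eq_square)
qed

text \<open>Extracts from the smallness condition, which concerns \<open>t > 0\<close> only, what it says at \<open>t = 0\<close>.\<close>

lemma nonpos_at_0_if_below_identity:
  fixes h :: "real \<Rightarrow> real"
  assumes "continuous_on {0..} h" "\<And>t. t > 0 \<Longrightarrow> h t < t"
  shows "h 0 \<le> 0"
proof (rule LIMSEQ_le)
  have lim: "(\<lambda>n. inverse (real (Suc n))) \<longlonglongrightarrow> 0"
    by (rule LIMSEQ_inverse_real_of_nat)
  then show "(\<lambda>n. h (inverse (real (Suc n)))) \<longlonglongrightarrow> h 0"
    by (intro continuous_on_tendsto_compose[OF assms(1)]) auto
  show "(\<lambda>n. inverse (real (Suc n))) \<longlonglongrightarrow> 0"
    by (fact lim)
  show "\<exists>N. \<forall>n\<ge>N. h (inverse (real (Suc n))) \<le> inverse (real (Suc n))"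
    using assms(2) by (auto intro!: less_imp_le)
qed

section \<open>Existence and uniqueness\<close>

theorem theorem4p1:
  fixes \<rho> r \<delta> L\<Gamma> MF MG :: real
    and f g :: "real \<Rightarrow> real \<Rightarrow> real"
    and \<Gamma> :: "(real \<Rightarrow> real) \<Rightarrow> real"
    and \<phi> \<psi> \<alpha> \<gamma> :: "real \<Rightarrow> real"
  assumes rho: "\<rho> > 0"
    and f_nz: "\<And>t x. t \<in> {0..\<rho>} \<Longrightarrow> f t x \<noteq> 0"
    and f_cont: "\<And>x. continuous_on {0..\<rho>} (\<lambda>t. f t x)"
    and g_cont: "\<And>x. continuous_on {0..\<rho>} (\<lambda>t. g t x)"
    and Gamma_lip: "lipschitz_CJ \<rho> L\<Gamma> \<Gamma>"
    and r: "r > 0"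
    and phi: "\<phi> \<in> {0..} \<rightarrow> {0..}" "mono_on {0..} \<phi>" "continuous_on {0..} \<phi>"
    and psi: "\<psi> \<in> {0..} \<rightarrow> {0..}" "mono_on {0..} \<psi>" "continuous_on {0..} \<psi>"
    and alpha: "\<alpha> \<in> {0..\<rho>} \<rightarrow> {0..}" "bounded (\<alpha> ` {0..\<rho>})"
    and gamma: "\<gamma> \<in> {0..\<rho>} \<rightarrow> {0..}" "bounded (\<gamma> ` {0..\<rho>})"
      "\<gamma> \<in> borel_measurable (lebesgue_on {0..\<rho>})"
    and f_mod: "\<And>t x y. t \<in> {0..\<rho>} \<Longrightarrow> \<bar>x\<bar> \<le> r \<Longrightarrow> \<bar>y\<bar> \<le> r \<Longrightarrow>
      \<bar>f t x - f t y\<bar> \<le> \<alpha> t * \<phi> \<bar>x - y\<bar>"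
    and g_mod: "\<And>t x y. t \<in> {0..\<rho>} \<Longrightarrow> \<bar>x\<bar> \<le> r \<Longrightarrow> \<bar>y\<bar> \<le> r \<Longrightarrow>
      \<bar>g t x - g t y\<bar> \<le> \<gamma> t * \<psi> \<bar>x - y\<bar>"
    and delta: "\<delta> > 0" "\<And>x. \<bar>x\<bar> \<le> r \<Longrightarrow> inverse \<bar>f 0 x\<bar> \<le> \<delta>"
    and MF: "MF = supnorm \<rho> \<alpha> * \<phi> r + supnorm \<rho> (\<lambda>t. f t 0)"
    and MG: "MG = \<delta> * (L\<Gamma> * r + \<bar>\<Gamma> (zeroJ \<rho>)\<bar>) + \<rho> * supnorm \<rho> \<gamma> * \<psi> r
      + \<rho> * supnorm \<rho> (\<lambda>t. g t 0)"
    and contraction: "\<And>t. t > 0 \<Longrightarrow>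
      MF * \<delta> * L\<Gamma> * t
      + (MF * \<delta>\<^sup>2 * \<alpha> 0 * (L\<Gamma> * r + \<bar>\<Gamma> (zeroJ \<rho>)\<bar>) + MG * supnorm \<rho> \<alpha>) * \<phi> t
      + MF * L1norm \<rho> \<gamma> * \<psi> t < t"
    and MF_MG: "MF * MG \<le> r"
  shows "\<exists>!x. x \<in> Bball \<rho> r \<and> is_solution \<rho> f g \<Gamma> x"
proof -
  define J where "J = {0..\<rho>}"
  define K where "K = L\<Gamma> * r + \<bar>\<Gamma> (zeroJ \<rho>)\<bar>"
  define A where "A = supnorm \<rho> \<alpha>"
  define L where "L = L1norm \<rho> \<gamma>"
  define N where "N = supnorm \<rho> \<gamma> * \<psi> r + supnorm \<rho> (\<lambda>t. g t 0)"
  define \<Phi> where "\<Phi> t = MF * \<delta> * L\<Gamma> * t + (MF * \<delta>\<^sup>2 * \<alpha> 0 * K + MG * A) * \<phi> t + MF * L * \<psi> t" for t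
  define I where "I x t = integral {0..t} (\<lambda>s. g s (x s))" for x t
  define G where "G x t = \<Gamma> x / f 0 (x 0) + I x t" for x t
  define T where "T x = restrict (\<lambda>t. f t (x t) * G x t) J" for x
  let ?B = "Bball \<rho> r"
  let ?d = "mdist (CJ_metric \<rho>)"

  have J0: "0 \<in> J"
    using rho by (simp add: J_def)
  have B: "x \<in> CJ \<rho>" "continuous_on J x" "\<And>t. t \<in> J \<Longrightarrow> \<bar>x t\<bar> \<le> r" if "x \<in> ?B" for x
    using that rho by (auto simp: Bball_iff J_def CJ_def)

  have L\<Gamma>: "0 \<le> L\<Gamma>" and \<Gamma>_diff: "\<bar>\<Gamma> x - \<Gamma> y\<bar> \<le> L\<Gamma> * ?d x y" if "x \<in> ?B" "y \<in> ?B" for x y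
    using Gamma_lip B(1) that rho by (auto simp: lipschitz_CJ_def mdist_CJ_metric)
  have "zeroJ \<rho> \<in> ?B"
    using rho r by (simp add: zeroJ_in_Bball)
  note L\<Gamma> = L\<Gamma>[OF this this]
  have "0 \<le> K"
    using L\<Gamma> r by (simp add: K_def)
  have \<Gamma>_bound: "\<bar>\<Gamma> x\<bar> \<le> K" if x: "x \<in> ?B" for x
  proof -
    have "L\<Gamma> * ?d x (zeroJ \<rho>) \<le> L\<Gamma> * r"
      using x rho L\<Gamma> by (intro mult_left_mono) (auto simp: Bball_def mdist_CJ_metric supnorm_minus_zeroJ)
    then show ?thesis
      using \<Gamma>_diff[OF x \<open>zeroJ \<rho> \<in> ?B\<close>] by (simp add: K_def)
  qed

  have \<alpha>: "0 \<le> \<alpha> t" "\<alpha> t \<le> A" if "t \<in> J" for t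
    using alpha abs_le_supnorm[OF alpha(2), of t] that by (auto simp: A_def J_def)
  have \<gamma>: "0 \<le> \<gamma> t" "\<gamma> t \<le> supnorm \<rho> \<gamma>" if "t \<in> J" for t
    using gamma abs_le_supnorm[OF gamma(2), of t] that by (auto simp: J_def)
  have \<phi>: "0 \<le> \<phi> t" and \<psi>: "0 \<le> \<psi> t" if "0 \<le> t" for t
    using phi(1) psi(1) that by auto
  have "0 \<le> A"
    using \<alpha> J0 by force
  have "0 \<le> supnorm \<rho> \<gamma>"
    using \<gamma> J0 by force
  have "0 \<le> L"
    by (simp add: L_def L1norm_def)
  have f_diff: "\<bar>f t y - f t z\<bar> \<le> \<alpha> t * \<phi> c"
    and g_diff: "\<bar>g t y - g t z\<bar> \<le> \<gamma> t * \<psi> c"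
    if "t \<in> J" "\<bar>y\<bar> \<le> r" "\<bar>z\<bar> \<le> r" "\<bar>y - z\<bar> \<le> c" for t y z c
  proof -
    have "\<phi> \<bar>y - z\<bar> \<le> \<phi> c" "\<psi> \<bar>y - z\<bar> \<le> \<psi> c"
      using that(4) by (auto intro!: mono_onD[OF phi(2)] mono_onD[OF psi(2)])
    then show "\<bar>f t y - f t z\<bar> \<le> \<alpha> t * \<phi> c" "\<bar>g t y - g t z\<bar> \<le> \<gamma> t * \<psi> c"
      using f_mod[of t y z] mult_left_mono[of _ _ "\<alpha> t"] \<alpha>(1)[of t]
        g_mod[of t y z] mult_left_mono[of _ _ "\<gamma> t"] \<gamma>(1)[of t] that
      by (fastforce simp: J_def)+
  qed
  have f_diff_A: "\<bar>f t y - f t z\<bar> \<le> A * \<phi> c"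
    and g_diff_sup: "\<bar>g t y - g t z\<bar> \<le> supnorm \<rho> \<gamma> * \<psi> c"
    if "t \<in> J" "\<bar>y\<bar> \<le> r" "\<bar>z\<bar> \<le> r" "\<bar>y - z\<bar> \<le> c" for t y z c
  proof -
    have "0 \<le> c"
      using that(4) by linarith
    then show "\<bar>f t y - f t z\<bar> \<le> A * \<phi> c" "\<bar>g t y - g t z\<bar> \<le> supnorm \<rho> \<gamma> * \<psi> c"
      using f_diff[OF that] mult_right_mono[OF \<alpha>(2)[OF that(1)] \<phi>[of c]]
        g_diff[OF that] mult_right_mono[OF \<gamma>(2)[OF that(1)] \<psi>[of c]] by linarith+
  qed
  have f_bound: "\<bar>f t y\<bar> \<le> MF" and g_bound: "\<bar>g t y\<bar> \<le> N" if "t \<in> J" "\<bar>y\<bar> \<le> r" for t y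
    using f_diff_A[of t y 0 r] g_diff_sup[of t y 0 r] that r
      abs_le_supnorm[OF bounded_continuous_image[OF f_cont[of 0]], of t]
      abs_le_supnorm[OF bounded_continuous_image[OF g_cont[of 0]], of t]
    by (auto simp: MF N_def A_def J_def)
  have "0 < MF"
    using f_bound[OF J0, of 0] f_nz[of 0 0] J0 r by (simp add: J_def)
  have "0 \<le> N"
    using g_bound[OF J0, of 0] r by simp
  have MG_eq: "MG = \<delta> * K + \<rho> * N"
    by (simp add: MG K_def N_def algebra_simps)
  have "0 \<le> MG"
    using \<open>0 \<le> K\<close> \<open>0 \<le> N\<close> delta(1) rho by (simp add: MG_eq)
  have inv_diff: "\<bar>inverse (f 0 y) - inverse (f 0 z)\<bar> \<le> \<delta>\<^sup>2 * \<bar>f 0 y - f 0 z\<bar>"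
    if "\<bar>y\<bar> \<le> r" "\<bar>z\<bar> \<le> r" for y z
    using that f_nz[of 0] J0 delta(2) by (intro abs_inverse_diff_le) (auto simp: J_def)

  have coeff: "0 \<le> MF * \<delta>\<^sup>2 * \<alpha> 0 * K"
    using \<open>0 < MF\<close> \<open>0 \<le> K\<close> \<alpha>(1)[OF J0] by simp
  have \<Phi>_less: "\<Phi> t < t" if "t > 0" for t
    using contraction[OF that] by (simp add: \<Phi>_def K_def A_def L_def)
  have \<Phi>_cont: "continuous_on {0..} \<Phi>"
    unfolding \<Phi>_def by (intro continuous_intros phi psi)
  have \<Phi>_mono: "mono_on {0..} \<Phi>"
  proof (rule mono_onI)
    fix s t :: real
    assume "s \<in> {0..}" "t \<in> {0..}" "s \<le> t"
    then have "\<phi> s \<le> \<phi> t" "\<psi> s \<le> \<psi> t"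
      by (auto intro!: mono_onD[OF phi(2)] mono_onD[OF psi(2)])
    then show "\<Phi> s \<le> \<Phi> t"
      unfolding \<Phi>_def
      using \<open>s \<le> t\<close> coeff \<open>0 < MF\<close> \<open>0 \<le> MG\<close> \<open>0 \<le> A\<close> \<open>0 \<le> L\<close> L\<Gamma> delta(1)
      by (intro add_mono mult_left_mono) auto
  qed

  \<comment> \<open>A sum of nonnegative terms that is at most \<open>0\<close>: each term vanishes. The two resulting
      dichotomies give the continuity of \<open>T x\<close> and of \<open>t \<mapsto> g t (x t)\<close> below.\<close>
  have "\<Phi> 0 \<le> 0"
    using nonpos_at_0_if_below_identity[OF \<Phi>_cont \<Phi>_less] .
  moreover have "\<Phi> 0 = MF * \<delta>\<^sup>2 * \<alpha> 0 * K * \<phi> 0 + MG * (A * \<phi> 0) + MF * (L * \<psi> 0)"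
    by (simp add: \<Phi>_def algebra_simps)
  moreover have "0 \<le> MF * \<delta>\<^sup>2 * \<alpha> 0 * K * \<phi> 0" "0 \<le> MG * (A * \<phi> 0)" "0 \<le> MF * (L * \<psi> 0)"
    using coeff \<open>0 < MF\<close> \<open>0 \<le> MG\<close> \<open>0 \<le> A\<close> \<open>0 \<le> L\<close> \<phi>[of 0] \<psi>[of 0] by auto
  ultimately have MGA: "MG * (A * \<phi> 0) = 0" and "MF * (L * \<psi> 0) = 0"
    by linarith+
  then have L\<psi>: "L * \<psi> 0 = 0"
    using \<open>0 < MF\<close> by simp

  have int_diff: "integral {0..t} (\<lambda>s. \<bar>u s - v s\<bar>) \<le> L * \<psi> c"
    if "continuous_on J u" "continuous_on J v" "\<And>s. s \<in> J \<Longrightarrow> \<bar>u s - v s\<bar> \<le> \<gamma> s * \<psi> c"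
      "0 \<le> c" "t \<in> J" for u v t c
    unfolding L_def
    using that \<gamma>(1) \<psi> gamma by (intro integral_abs_diff_le_L1norm) (auto simp: J_def)

  have g_cont_comp: "continuous_on J (\<lambda>t. g t (x t))" if x: "x \<in> ?B" for x
  proof (cases "\<psi> 0 = 0")
    case True
    show ?thesis
      by (rule continuous_on_superposition[where \<omega> = "\<lambda>c. supnorm \<rho> \<gamma> * \<psi> c" and r = r])
        (use B[OF x] g_cont psi(3) g_diff_sup True in \<open>auto simp: J_def intro: continuous_intros\<close>)
  next
    case False
    then have "L = 0"
      using L\<psi> by simp
    \<comment> \<open>The integral of \<open>\<bar>g s y - g s 0\<bar>\<close> is at most \<open>L * \<psi> r = 0\<close>, and its integrand is continuous.\<close>
    have const: "g t y = g t 0" if "t \<in> J" "\<bar>y\<bar> \<le> r" for t y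
    proof -
      let ?u = "\<lambda>s. \<bar>g s y - g s 0\<bar>"
      have cont: "continuous_on {0..\<rho>} ?u"
        by (intro continuous_intros g_cont)
      have "integral {0..\<rho>} ?u \<le> L * \<psi> r"
        using that r rho g_cont g_diff[of _ y 0 r] by (intro int_diff) (auto simp: J_def)
      moreover have "0 \<le> integral {0..\<rho>} ?u"
        by (intro integral_nonneg integrable_continuous_real cont) simp
      ultimately have "integral (cbox 0 \<rho>) ?u = 0"
        using \<open>L = 0\<close> by simp
      then have "?u t = 0"
        using integral_cbox_eq_0_iff[of 0 \<rho> ?u] cont that(1) rho by (auto simp: J_def)
      then show ?thesis
        by simp
    qed
    show ?thesis
      by (rule continuous_on_eq[OF g_cont[of 0, folded J_def]]) (use const B(3)[OF x] in simp)
  qed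

  have I_cont: "continuous_on J (I x)" if "x \<in> ?B" for x
    unfolding I_def J_def
    by (intro indefinite_integral_continuous_1 integrable_continuous_real g_cont_comp[OF that, unfolded J_def])
  have int_on: "(\<lambda>s. g s (x s)) integrable_on {0..t}" if "x \<in> ?B" "t \<in> J" for x t
    using that(2) by (intro integrable_continuous_real continuous_on_subset[OF g_cont_comp[OF that(1)]])
      (auto simp: J_def)
  have I_bound: "\<bar>I x t\<bar> \<le> \<rho> * N" if "x \<in> ?B" "t \<in> J" for x t
  proof -
    have "norm (integral {0..t} (\<lambda>s. g s (x s))) \<le> N * (t - 0)"
      using that B(3)[OF that(1)] g_bound
      by (intro integral_bound continuous_on_subset[OF g_cont_comp[OF that(1)]]) (auto simp: J_def)
    also have "\<dots> \<le> N * \<rho>"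
      using that(2) \<open>0 \<le> N\<close> by (intro mult_left_mono) (auto simp: J_def)
    finally show ?thesis
      by (simp add: I_def mult.commute)
  qed
  have quot_bound: "\<bar>\<Gamma> x / f 0 (x 0)\<bar> \<le> \<delta> * K" if "x \<in> ?B" for x
    using mult_mono[OF \<Gamma>_bound[OF that] delta(2)[OF B(3)[OF that J0]]] \<open>0 \<le> K\<close>
    by (simp add: abs_mult divide_inverse mult.commute)
  have G_bound: "\<bar>G x t\<bar> \<le> MG" if "x \<in> ?B" "t \<in> J" for x t
    using quot_bound[OF that(1)] I_bound[OF that] unfolding G_def MG_eq by linarith

  have T_cont: "continuous_on J (\<lambda>t. f t (x t) * G x t)" if x: "x \<in> ?B" for x
  proof (cases "A * \<phi> 0 = 0")
    case True
    have "continuous_on J (\<lambda>t. f t (x t))"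
      by (rule continuous_on_superposition[where \<omega> = "\<lambda>c. A * \<phi> c" and r = r])
        (use B[OF x] f_cont phi(3) f_diff_A True in \<open>auto simp: J_def intro: continuous_intros\<close>)
    then show ?thesis
      unfolding G_def by (intro continuous_intros I_cont[OF x])
  next
    case False
    then have "MG = 0"
      using MGA by simp
    \<comment> \<open>Here \<open>t \<mapsto> f t (x t)\<close> may be discontinuous, but its factor \<open>G x\<close> vanishes.\<close>
    then have "f t (x t) * G x t = 0" if "t \<in> J" for t
      using G_bound[OF x that] by simp
    then show ?thesis
      by (intro continuous_on_eq[OF continuous_on_const[of J 0]]) simp
  qed
  have T_B: "T x \<in> ?B" if x: "x \<in> ?B" for x
  proof -
    have "\<bar>T x t\<bar> \<le> r" if "t \<in> J" for t
    proof -
      have "\<bar>f t (x t) * G x t\<bar> \<le> MF * MG"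
        unfolding abs_mult
        using f_bound[OF that B(3)[OF x that]] G_bound[OF x that] \<open>0 < MF\<close> by (intro mult_mono) auto
      then show ?thesis
        using MF_MG that by (simp add: T_def)
    qed
    moreover have "continuous_on J (T x)"
      by (rule continuous_on_eq[OF T_cont[OF x]]) (simp add: T_def)
    then have "T x \<in> CJ \<rho>"
      by (simp add: CJ_def T_def flip: J_def)
    ultimately show ?thesis
      using rho by (simp add: Bball_iff J_def)
  qed

  have T_contr: "?d (T x) (T y) \<le> \<Phi> (?d x y)" if x: "x \<in> ?B" and y: "y \<in> ?B" for x y
  proof -
    define c where "c = ?d x y"
    have close: "\<bar>x t - y t\<bar> \<le> c" if "t \<in> J" for t
    proof -
      have "bounded ((\<lambda>t. x t - y t) ` {0..\<rho>})"
        using B(2)[OF x] B(2)[OF y] unfolding J_def by (intro bounded_continuous_image continuous_intros)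
      then show ?thesis
        using abs_le_supnorm[of "\<lambda>t. x t - y t"] that B(1) x y rho
        by (simp add: c_def mdist_CJ_metric J_def)
    qed
    then have "0 \<le> c"
      using J0 abs_ge_zero order_trans by blast
    have F: "\<bar>f t (x t) - f t (y t)\<bar> \<le> \<alpha> t * \<phi> c" and F_A: "\<bar>f t (x t) - f t (y t)\<bar> \<le> A * \<phi> c"
      if "t \<in> J" for t
      using f_diff f_diff_A close B(3)[OF x] B(3)[OF y] that by auto

    have quot: "\<bar>\<Gamma> x / f 0 (x 0) - \<Gamma> y / f 0 (y 0)\<bar> \<le> \<delta> * L\<Gamma> * c + \<delta>\<^sup>2 * \<alpha> 0 * K * \<phi> c"
    proof -
      have "\<Gamma> x / f 0 (x 0) - \<Gamma> y / f 0 (y 0) =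
          inverse (f 0 (x 0)) * (\<Gamma> x - \<Gamma> y) + \<Gamma> y * (inverse (f 0 (x 0)) - inverse (f 0 (y 0)))"
        by (simp add: divide_inverse algebra_simps)
      also have "\<bar>\<dots>\<bar> \<le> inverse \<bar>f 0 (x 0)\<bar> * \<bar>\<Gamma> x - \<Gamma> y\<bar>
          + \<bar>\<Gamma> y\<bar> * \<bar>inverse (f 0 (x 0)) - inverse (f 0 (y 0))\<bar>"
        by (rule order_trans[OF abs_triangle_ineq]) (simp add: abs_mult)
      also have "\<dots> \<le> \<delta> * (L\<Gamma> * c) + K * (\<delta>\<^sup>2 * (\<alpha> 0 * \<phi> c))"
      proof (intro add_mono mult_mono)
        show "\<bar>inverse (f 0 (x 0)) - inverse (f 0 (y 0))\<bar> \<le> \<delta>\<^sup>2 * (\<alpha> 0 * \<phi> c)"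
          using inv_diff[OF B(3)[OF x J0] B(3)[OF y J0]] mult_left_mono[OF F[OF J0], of "\<delta>\<^sup>2"] by simp
      qed (use delta B(3)[OF x J0] \<Gamma>_diff[OF x y] \<Gamma>_bound[OF y] \<open>0 \<le> K\<close> in \<open>auto simp: c_def\<close>)
      finally show ?thesis
        by (simp add: algebra_simps)
    qed
    have "\<bar>I x t - I y t\<bar> \<le> L * \<psi> c" if t: "t \<in> J" for t
    proof -
      have "\<bar>I x t - I y t\<bar> = norm (integral {0..t} (\<lambda>s. g s (x s) - g s (y s)))"
        unfolding I_def by (simp add: integral_diff[OF int_on[OF x t] int_on[OF y t]])
      also have "\<dots> \<le> integral {0..t} (\<lambda>s. \<bar>g s (x s) - g s (y s)\<bar>)"
      proof (rule integral_norm_bound_integral)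
        show "(\<lambda>s. g s (x s) - g s (y s)) integrable_on {0..t}"
          by (intro integrable_diff int_on x y t)
        show "(\<lambda>s. \<bar>g s (x s) - g s (y s)\<bar>) integrable_on {0..t}"
          by (intro integrable_continuous_real continuous_intros
              continuous_on_subset[OF g_cont_comp[OF x]] continuous_on_subset[OF g_cont_comp[OF y]])
            (use t in \<open>auto simp: J_def\<close>)
      qed simp
      also have "\<dots> \<le> L * \<psi> c"
        using g_diff close B(3)[OF x] B(3)[OF y] by (intro int_diff g_cont_comp x y t \<open>0 \<le> c\<close>) auto
      finally show ?thesis .
    qed
    with quot have G_diff: "\<bar>G x t - G y t\<bar> \<le> \<delta> * L\<Gamma> * c + \<delta>\<^sup>2 * \<alpha> 0 * K * \<phi> c + L * \<psi> c"
      if "t \<in> J" for t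
      using that unfolding G_def by fastforce

    have "\<bar>T x t - T y t\<bar> \<le> \<Phi> c" if t: "t \<in> J" for t
    proof -
      have "T x t - T y t = f t (x t) * (G x t - G y t) + G y t * (f t (x t) - f t (y t))"
        using t by (simp add: T_def algebra_simps)
      also have "\<bar>\<dots>\<bar> \<le> \<bar>f t (x t)\<bar> * \<bar>G x t - G y t\<bar> + \<bar>G y t\<bar> * \<bar>f t (x t) - f t (y t)\<bar>"
        by (rule order_trans[OF abs_triangle_ineq]) (simp add: abs_mult)
      also have "\<dots> \<le> MF * (\<delta> * L\<Gamma> * c + \<delta>\<^sup>2 * \<alpha> 0 * K * \<phi> c + L * \<psi> c) + MG * (A * \<phi> c)"
        using f_bound[OF t B(3)[OF x t]] G_diff[OF t] G_bound[OF y t] F_A[OF t] \<open>0 < MF\<close> \<open>0 \<le> MG\<close>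
        by (intro add_mono mult_mono) auto
      also have "\<dots> = \<Phi> c"
        by (simp add: \<Phi>_def algebra_simps)
      finally show ?thesis .
    qed
    then show ?thesis
      using rho B(1)[OF T_B] x y
      by (simp add: mdist_CJ_metric[of \<rho> "T x" "T y"] flip: c_def) (intro supnorm_le; simp add: J_def)
  qed

  interpret Metric_space ?B ?d
    using rho r by (intro Metric_space_Bball) auto
  have "\<exists>!x. x \<in> ?B \<and> T x = x"
  proof (rule Browder_fixed_point[OF _ _ _ \<Phi>_mono \<Phi>_cont \<Phi>_less T_contr])
    show mcomplete
      using rho r by (intro mcomplete_Bball) auto
    show "?B \<noteq> {}"
      using \<open>zeroJ \<rho> \<in> ?B\<close> by blast
    show "T \<in> ?B \<rightarrow> ?B"
      using T_B by blast
  qed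
  moreover have "T x = x \<longleftrightarrow> is_solution \<rho> f g \<Gamma> x" if x: "x \<in> ?B" for x
  proof -
    have "T x = x \<longleftrightarrow> (\<forall>t\<in>J. f t (x t) * G x t = x t)"
      using B(1)[OF x] by (auto simp: T_def CJ_def J_def fun_eq_iff extensional_def restrict_def)
    also have "\<dots> \<longleftrightarrow> is_solution \<rho> f g \<Gamma> x"
      using is_solution_iff_fixed_point[of \<rho> f x g \<Gamma>] rho f_nz B(1)[OF x] g_cont_comp[OF x]
      by (auto simp: J_def G_def I_def)
    finally show ?thesis .
  qed
  ultimately show ?thesis
    by metis
qed

end
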